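(* Let $\mathcal O$ and $\mathcal O'$ be $\mathrm{Tw}$-coalgebras with structure maps $c$ and $c'$, and let $\Psi:\mathcal O\to\mathcal O'$ be a map of $\mathrm{Tw}$-coalgebras. Then the diagram of functors $$\begin{array}{ccc}\mathrm{Alg}^{\mathrm{MC}}_{\mathcal O'}&\xrightarrow{\ \Psi^*\ }&\mathrm{Alg}^{\mathrm{MC}}_{\mathcal O}\\ {\scriptstyle\mathrm{ATw}_{\mathcal O'}}\downarrow&&\downarrow{\scriptstyle\mathrm{ATw}_{\mathcal O}}\\ \mathrm{Alg}_{\mathcal O'}&\xrightarrow{\ \Psi^*\ }&\mathrm{Alg}_{\mathcal O}\end{array}$$ commutes, i.e. $\mathrm{ATw}_{\mathcal O}\circ\Psi^*=\Psi^*\circ\mathrm{ATw}_{\mathcal O'}$.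
   Context: **Conventions.** $\mathbb K$ is a field of characteristic zero. A dg operad is a unital symmetric operad in unbounded cochain complexes over $\mathbb K$ (differentials of degree $+1$), with elementary insertions $\circ_i$. $\mathbf s$ raises degree by one. $\mathrm{Sh}_{p,q}\subset S_{p+q}$ is the set of $\sigma$ with $\sigma(1)<\dots<\sigma(p)$ and $\sigma(p+1)<\dots<\sigma(p+q)$. For $v\in\mathcal O(k)$, $w\in\mathcal O(m)$, an expression $v(i_1,\dots,w(j_1,\dots,j_m),\dots)$ in which each of $1,\dots,k+m-1$ occurs once denotes the operadic composite with inputs labelled as displayed. $\mathrm{Alg}_{\mathcal O}$ is the category of $\mathcal O$-algebras. **$\Lambda\mathsf{Lie}_\infty$** is the dg operad free as a graded operad on $S_n$-invariant generators $\lambda_n$, arity $n\ge2$, degree $3-2n$, with $\partial\lambda_n=-\sum_{p=2}^{n-1}\sum_{\sigma\in\mathrm{Sh}_{p,n-p}}\sigma(\lambda_{n-p+1}\circ_1\lambda_p)$. **$\mathrm{Tw}$.** Given $\hat\varphi:\Lambda\mathsf{Lie}_\infty\to\mathcal O$, put $\varphi_n=\hat\varphi(\lambda_n)$ for $n\ge2$, $\varphi_1=0$. $\mathrm{Tw}\,\mathcal O(n)=\prod_{r\ge0}\mathbf s^{2r}(\mathcal O(r+n))^{S_r}$, where $S_r\subset S_{r+n}$ permutes the first $r$ letters: a homogeneous $f$ is a sequence $(f_r)_{r\ge0}$ with $f_r\in\mathcal O(r+n)^{S_r}$ of degree $|f|-2r$. $S_n$ acts on the last $n$ inputs; the unit is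 $(u_{\mathcal O},0,0,\dots)$; for $f\in\mathrm{Tw}\,\mathcal O(n)$, $g\in\mathrm{Tw}\,\mathcal O(m)$, $$(f\circ_ig)_r=\sum_{p=0}^r\sum_{\sigma\in\mathrm{Sh}_{p,r-p}}f_p(\sigma(1),\dots,\sigma(p),r+1,\dots,r+i-1,g_{r-p}(\sigma(p+1),\dots,\sigma(r),r+i,\dots,r+i+m-1),r+i+m,\dots,r+n+m-1).$$ With $\kappa\in\mathrm{Tw}\,\mathcal O(1)$, $\kappa_r=\varphi_{r+1}$, $$(\partial^{\mathrm{Tw}}f)_r=\partial^{\mathcal O}f_r-(-1)^{|f|}\sum_{p=1}^r\sum_{\sigma\in\mathrm{Sh}_{p,r-p}}f_{r-p+1}(\varphi_p(\sigma(1),\dots,\sigma(p)),\sigma(p+1),\dots,\sigma(r),r+1,\dots,r+n)+(\kappa\circ_1f)_r-(-1)^{|f|}\sum_{i=1}^n(f\circ_i\kappa)_r.$$ $\beta_{\mathcal O}(\lambda_n)_r=\varphi_{r+n}$ defines $\beta_{\mathcal O}:\Lambda\mathsf{Lie}_\infty\to\mathrm{Tw}\,\mathcal O$; $(\mathrm{Tw}\,G)(f)_r=G(f_r)$; $\eta_{\mathcal O}(f)=f_0$; $((\mathfrak D_{\mathcal O}f)_r)_s=f_{s+r}$. A $\mathrm{Tw}$-coalgebra is $\hat\varphi:\Lambda\mathsf{Lie}_\infty\to\mathcal O$ with a dg operad map $c:\mathcal O\to\mathrm{Tw}\,\mathcal O$ such that $c\hat\varphi=\beta_{\mathcal O}$,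 $\eta_{\mathcal O}c=\mathrm{id}$, $\mathrm{Tw}(c)\,c=\mathfrak D_{\mathcal O}\,c$. A map of $\mathrm{Tw}$-coalgebras is a dg operad map $\Psi$ with $\Psi\hat\varphi=\hat\varphi'$ and $c'\Psi=\mathrm{Tw}(\Psi)c$. **$\mathrm{Alg}^{\mathrm{MC}}_{\mathcal O}$ and $\mathrm{ATw}_{\mathcal O}$.** Objects of $\mathrm{Alg}^{\mathrm{MC}}_{\mathcal O}$ are pairs $(V,\alpha)$: $V$ an $\mathcal O$-algebra with a complete descending filtration $V=\mathcal F_0V\supset\mathcal F_1V\supset\cdots$, $V=\lim V/\mathcal F_kV$, compatible with the $\mathcal O$-structure (the differential preserves it, and operations map $\mathcal F_{i_1}V\otimes\dots\otimes\mathcal F_{i_n}V$ to $\mathcal F_{i_1+\dots+i_n}V$), and $\alpha\in\mathcal F_1V$ of degree $2$ with $\partial\alpha+\sum_{n\ge2}\frac1{n!}\varphi_n(\alpha,\dots,\alpha)=0$. Morphisms are morphisms of filtered $\mathcal O$-algebras $f$ with $f(\alpha)=\alpha'$. $\mathrm{ATw}_{\mathcal O}(V,\alpha)$ is $V$ with differential $\partial^\alpha(v)=\partial v+\sum_{r\ge1}\frac1{r!}\varphi_{r+1}(\alpha,\dots,\alpha,v)$ and the $\mathcal O$-algebra structure in which $\gamma\in\mathcal O(n)$ acts by $(v_1,\dots,v_n)\mapsto\sum_{r\ge0}\frac1{r!}c(\gamma)_r(\alpha,\dots,\alpha,v_1,\dots,v_n)$; on morphisms it is the identity on underlying maps. $\Psi^*$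 is restriction of the algebra structure along $\Psi$ (keeping the filtration and $\alpha$). *)

theory Defs
  imports
    Complex_Main
    "HOL-Library.FuncSet"
    "HOL-Library.Function_Algebras"
    "HOL-Library.Poly_Mapping"
    "HOL-Combinatorics.Permutations"
begin

text \<open>
  Graded vector spaces over the field \<open>'k\<close> are families of subspaces, indexed by the degree, of an
  ambient vector space; only homogeneous elements are used.  The pieces of a family are not required
  to be independent in the ambient space, so every operation on homogeneous elements takes the
  degrees (and, for operads, the arities) of its arguments as additional arguments.  Maps between
  families are extensional on each piece in the sense of \<^theory>\<open>HOL-Library.FuncSet\<close>, so that
  equality of maps is equality of HOL functions.
\<close>

definition sg :: "int \<Rightarrow> 'a::ab_group_add \<Rightarrow> 'a" where
  "sg d x = (if even d then x else - x)"

definition lin_on :: "('k \<Rightarrow> 'a \<Rightarrow> 'a) \<Rightarrow> ('k \<Rightarrow> 'b \<Rightarrow> 'b) \<Rightarrow> 'a set \<Rightarrow> ('a::ab_group_add \<Rightarrow> 'b::ab_group_add) \<Rightarrow> bool" where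
  "lin_on s t U f \<longleftrightarrow>
     (\<forall>x\<in>U. \<forall>y\<in>U. f (x + y) = f x + f y) \<and> (\<forall>a. \<forall>x\<in>U. f (s a x) = t a (f x))"

definition Sh :: "nat \<Rightarrow> nat \<Rightarrow> (nat \<Rightarrow> nat) set" where
  "Sh p q = {\<sigma>. \<sigma> permutes {1..p+q} \<and> strict_mono_on {1..p} \<sigma> \<and> strict_mono_on {p+1..p+q} \<sigma>}"

section \<open>Operads\<close>

text \<open>
  \<open>op_circ P k d m e i v w\<close> is \<open>v \<circ>\<^sub>i w\<close> for \<open>v\<close> of arity \<open>k\<close> and degree \<open>d\<close> and \<open>w\<close> of arity \<open>m\<close>
  and degree \<open>e\<close>.  Permutations act from the left: \<open>op_act P n d \<sigma> v\<close> is \<open>v(\<sigma>(1),\<dots>,\<sigma>(n))\<close>, the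
  operation whose \<open>j\<close>-th slot carries the label \<open>\<sigma>(j)\<close>.
\<close>

record ('k, 'o) graded_operad =
  op_car :: "nat \<Rightarrow> int \<Rightarrow> 'o set"
  op_scale :: "'k \<Rightarrow> 'o \<Rightarrow> 'o"
  op_unit :: "'o"
  op_act :: "nat \<Rightarrow> int \<Rightarrow> (nat \<Rightarrow> nat) \<Rightarrow> 'o \<Rightarrow> 'o"
  op_circ :: "nat \<Rightarrow> int \<Rightarrow> nat \<Rightarrow> int \<Rightarrow> nat \<Rightarrow> 'o \<Rightarrow> 'o \<Rightarrow> 'o"

record ('k, 'o) dg_operad = "('k, 'o) graded_operad" +
  op_diff :: "nat \<Rightarrow> int \<Rightarrow> 'o \<Rightarrow> 'o"

text \<open>\<open>op_label P d [i\<^sub>1,\<dots>,i\<^sub>n] v\<close> is \<open>v(i\<^sub>1,\<dots>,i\<^sub>n)\<close>.\<close>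

definition perm_of_labels :: "nat list \<Rightarrow> nat \<Rightarrow> nat" where
  "perm_of_labels is j = (if j \<in> {1..length is} then is ! (j - 1) else j)"

definition op_label :: "('k, 'o, 'z) graded_operad_scheme \<Rightarrow> int \<Rightarrow> nat list \<Rightarrow> 'o \<Rightarrow> 'o" where
  "op_label P d is v = op_act P (length is) d (perm_of_labels is) v"

text \<open>
  \<open>op_comp_label P d e v is w js ls\<close> is \<open>v(is, w(js), ls)\<close>, for \<open>v\<close> of degree \<open>d\<close> and \<open>w\<close> of
  degree \<open>e\<close>.
\<close>

definition op_comp_label ::
    "('k, 'o, 'z) graded_operad_scheme \<Rightarrow> int \<Rightarrow> int \<Rightarrow> 'o \<Rightarrow> nat list \<Rightarrow> 'o \<Rightarrow> nat list \<Rightarrow> nat list \<Rightarrow> 'o" where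
  "op_comp_label P d e v is w js ls =
     op_label P (d + e) (is @ js @ ls)
       (op_circ P (length is + 1 + length ls) d (length js) e (length is + 1) v w)"

locale is_graded_operad =
  fixes P :: "('k::field, 'o::ab_group_add, 'z) graded_operad_scheme"
  assumes scale: "vector_space (op_scale P)"
    and car: "module.subspace (op_scale P) (op_car P n d)"
    and unit_car: "op_unit P \<in> op_car P 1 0"
    and act_car: "\<sigma> permutes {1..n} \<Longrightarrow> v \<in> op_car P n d \<Longrightarrow> op_act P n d \<sigma> v \<in> op_car P n d"
    and act_lin: "\<sigma> permutes {1..n} \<Longrightarrow>
      lin_on (op_scale P) (op_scale P) (op_car P n d) (op_act P n d \<sigma>)"
    and act_id: "v \<in> op_car P n d \<Longrightarrow> op_act P n d id v = v"
    and act_comp: "\<sigma> permutes {1..n} \<Longrightarrow> \<tau> permutes {1..n} \<Longrightarrow> v \<in> op_car P n d \<Longrightarrow>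
      op_act P n d (\<sigma> \<circ> \<tau>) v = op_act P n d \<sigma> (op_act P n d \<tau> v)"
    and circ_car: "1 \<le> i \<Longrightarrow> i \<le> k \<Longrightarrow> v \<in> op_car P k d \<Longrightarrow> w \<in> op_car P m e \<Longrightarrow>
      op_circ P k d m e i v w \<in> op_car P (k + m - 1) (d + e)"
    and circ_lin_left: "1 \<le> i \<Longrightarrow> i \<le> k \<Longrightarrow> w \<in> op_car P m e \<Longrightarrow>
      lin_on (op_scale P) (op_scale P) (op_car P k d) (\<lambda>v. op_circ P k d m e i v w)"
    and circ_lin_right: "1 \<le> i \<Longrightarrow> i \<le> k \<Longrightarrow> v \<in> op_car P k d \<Longrightarrow>
      lin_on (op_scale P) (op_scale P) (op_car P m e) (\<lambda>w. op_circ P k d m e i v w)"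
    and unit_left: "v \<in> op_car P k d \<Longrightarrow> op_circ P 1 0 k d 1 (op_unit P) v = v"
    and unit_right: "1 \<le> i \<Longrightarrow> i \<le> k \<Longrightarrow> v \<in> op_car P k d \<Longrightarrow>
      op_circ P k d 1 0 i v (op_unit P) = v"
    and assoc_seq: "1 \<le> i \<Longrightarrow> i \<le> k \<Longrightarrow> 1 \<le> j \<Longrightarrow> j \<le> m \<Longrightarrow>
      v \<in> op_car P k d \<Longrightarrow> w \<in> op_car P m e \<Longrightarrow> x \<in> op_car P l f \<Longrightarrow>
      op_circ P (k + m - 1) (d + e) l f (i + j - 1) (op_circ P k d m e i v w) x =
      op_circ P k d (m + l - 1) (e + f) i v (op_circ P m e l f j w x)"
    and assoc_par: "1 \<le> i \<Longrightarrow> i < j \<Longrightarrow> j \<le> k \<Longrightarrow>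
      v \<in> op_car P k d \<Longrightarrow> w \<in> op_car P m e \<Longrightarrow> x \<in> op_car P l f \<Longrightarrow>
      op_circ P (k + m - 1) (d + e) l f (j + m - 1) (op_circ P k d m e i v w) x =
      sg (e * f) (op_circ P (k + l - 1) (d + f) m e i (op_circ P k d l f j v x) w)"
    and equiv_left: "1 \<le> j \<Longrightarrow> j \<le> k \<Longrightarrow> \<sigma> permutes {1..k} \<Longrightarrow>
      v \<in> op_car P k d \<Longrightarrow> w \<in> op_car P m e \<Longrightarrow>
      op_circ P k d m e (\<sigma> j) (op_act P k d \<sigma> v) w =
      op_label P (d + e)
        (concat (map (\<lambda>s. if s = j then [\<sigma> j..<\<sigma> j + m]
                          else if \<sigma> s < \<sigma> j then [\<sigma> s] else [\<sigma> s + m - 1]) [1..<k + 1]))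
        (op_circ P k d m e j v w)"
    and equiv_right: "1 \<le> i \<Longrightarrow> i \<le> k \<Longrightarrow> \<tau> permutes {1..m} \<Longrightarrow>
      v \<in> op_car P k d \<Longrightarrow> w \<in> op_car P m e \<Longrightarrow>
      op_circ P k d m e i v (op_act P m e \<tau> w) =
      op_label P (d + e)
        ([1..<i] @ map (\<lambda>q. i - 1 + \<tau> q) [1..<m + 1] @ [i + m..<k + m])
        (op_circ P k d m e i v w)"

locale is_dg_operad = is_graded_operad P
  for P :: "('k::field, 'o::ab_group_add, 'z) dg_operad_scheme" (structure) +
  assumes diff_car: "v \<in> op_car P n d \<Longrightarrow> op_diff P n d v \<in> op_car P n (d + 1)"
    and diff_lin: "lin_on (op_scale P) (op_scale P) (op_car P n d) (op_diff P n d)"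
    and diff_diff: "v \<in> op_car P n d \<Longrightarrow> op_diff P n (d + 1) (op_diff P n d v) = 0"
    and diff_act: "\<sigma> permutes {1..n} \<Longrightarrow> v \<in> op_car P n d \<Longrightarrow>
      op_diff P n d (op_act P n d \<sigma> v) = op_act P n (d + 1) \<sigma> (op_diff P n d v)"
    and diff_circ: "1 \<le> i \<Longrightarrow> i \<le> k \<Longrightarrow> v \<in> op_car P k d \<Longrightarrow> w \<in> op_car P m e \<Longrightarrow>
      op_diff P (k + m - 1) (d + e) (op_circ P k d m e i v w) =
      op_circ P k (d + 1) m e i (op_diff P k d v) w +
      sg d (op_circ P k d m (e + 1) i v (op_diff P m e w))"

type_synonym ('o, 'p) op_map = "nat \<Rightarrow> int \<Rightarrow> 'o \<Rightarrow> 'p"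

definition graded_operad_map ::
    "('k, 'o::ab_group_add, 'y) graded_operad_scheme \<Rightarrow> ('k, 'p::ab_group_add, 'z) graded_operad_scheme \<Rightarrow>
     ('o, 'p) op_map \<Rightarrow> bool" where
  "graded_operad_map P Q F \<longleftrightarrow>
     (\<forall>n d. F n d \<in> op_car P n d \<rightarrow>\<^sub>E op_car Q n d) \<and>
     (\<forall>n d. lin_on (op_scale P) (op_scale Q) (op_car P n d) (F n d)) \<and>
     F 1 0 (op_unit P) = op_unit Q \<and>
     (\<forall>n d \<sigma>. \<sigma> permutes {1..n} \<longrightarrow>
        (\<forall>v\<in>op_car P n d. F n d (op_act P n d \<sigma> v) = op_act Q n d \<sigma> (F n d v))) \<and>
     (\<forall>k d m e i. 1 \<le> i \<longrightarrow> i \<le> k \<longrightarrow> (\<forall>v\<in>op_car P k d. \<forall>w\<in>op_car P m e.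
        F (k + m - 1) (d + e) (op_circ P k d m e i v w) = op_circ Q k d m e i (F k d v) (F m e w)))"

definition dg_operad_map ::
    "('k, 'o::ab_group_add, 'y) dg_operad_scheme \<Rightarrow> ('k, 'p::ab_group_add, 'z) dg_operad_scheme \<Rightarrow>
     ('o, 'p) op_map \<Rightarrow> bool" where
  "dg_operad_map P Q F \<longleftrightarrow> graded_operad_map P Q F \<and>
     (\<forall>n d. \<forall>v\<in>op_car P n d. F n (d + 1) (op_diff P n d v) = op_diff Q n d (F n d v))"

definition op_id :: "('k, 'o, 'z) graded_operad_scheme \<Rightarrow> ('o, 'o) op_map" where
  "op_id P n d = (\<lambda>v\<in>op_car P n d. v)"

text \<open>The first argument is the source of \<open>F\<close>.\<close>

definition op_compose ::
    "('k, 'o, 'z) graded_operad_scheme \<Rightarrow> ('p, 'q) op_map \<Rightarrow> ('o, 'p) op_map \<Rightarrow> ('o, 'q) op_map" where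
  "op_compose P G F n d = compose (op_car P n d) (G n d) (F n d)"

section \<open>The operad \<open>\<Lambda>Lie\<^sub>\<infinity>\<close>\<close>

definition invariant_gens :: "('k, 'o, 'z) graded_operad_scheme \<Rightarrow> (nat \<Rightarrow> 'o) \<Rightarrow> bool" where
  "invariant_gens P g \<longleftrightarrow>
     (\<forall>n\<ge>2. g n \<in> op_car P n (3 - 2 * int n) \<and>
        (\<forall>\<sigma>. \<sigma> permutes {1..n} \<longrightarrow> op_act P n (3 - 2 * int n) \<sigma> (g n) = g n))"

text \<open>
  \<open>is_Lambda_Lie_inf L lam\<close>: \<open>L\<close> is the operad \<open>\<Lambda>Lie\<^sub>\<infinity>\<close> with generators \<open>\<lambda>\<^sub>n = lam n\<close>.  Freeness as
  a graded operad is the universal property.  HOL cannot quantify over the types of the target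
  operads, but a free operad on countably many generators has countable dimension, so it can be
  realised in the space \<open>nat \<Rightarrow>\<^sub>0 'k\<close> of countable dimension.  Hence the universal property
  for operads on that ambient space determines \<open>L\<close> up to isomorphism as the free graded operad and
  implies the universal property for arbitrary targets.
\<close>

definition is_Lambda_Lie_inf ::
    "('k::field_char_0, nat \<Rightarrow>\<^sub>0 'k) dg_operad \<Rightarrow> (nat \<Rightarrow> (nat \<Rightarrow>\<^sub>0 'k)) \<Rightarrow> bool" where
  "is_Lambda_Lie_inf L lam \<longleftrightarrow>
     is_dg_operad L \<and> invariant_gens L lam \<and>
     (\<forall>(Q :: ('k, nat \<Rightarrow>\<^sub>0 'k) graded_operad) g. is_graded_operad Q \<longrightarrow> invariant_gens Q g \<longrightarrow>
        (\<exists>!F. graded_operad_map L Q F \<and> (\<forall>n\<ge>2. F n (3 - 2 * int n) (lam n) = g n))) \<and>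
     (\<forall>n\<ge>2. op_diff L n (3 - 2 * int n) (lam n) =
        - (\<Sum>p=2..n-1. \<Sum>\<sigma>\<in>Sh p (n - p).
             op_act L n (4 - 2 * int n) \<sigma>
               (op_circ L (n - p + 1) (3 - 2 * int (n - p + 1)) p (3 - 2 * int p) 1
                  (lam (n - p + 1)) (lam p))))"

text \<open>\<open>phi lam F n\<close> is \<open>\<phi>\<^sub>n\<close>, with \<open>\<phi>\<^sub>1 = 0\<close>; the value at \<open>0\<close> is never used.\<close>

definition phi :: "(nat \<Rightarrow> 'l) \<Rightarrow> ('l, 'o::zero) op_map \<Rightarrow> nat \<Rightarrow> 'o" where
  "phi lam F n = (if n \<ge> 2 then F n (3 - 2 * int n) (lam n) else 0)"

section \<open>The comonad \<open>Tw\<close>\<close>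

definition Tw_car :: "('k, 'o, 'z) graded_operad_scheme \<Rightarrow> nat \<Rightarrow> int \<Rightarrow> (nat \<Rightarrow> 'o) set" where
  "Tw_car P n d = {f. \<forall>r. f r \<in> op_car P (r + n) (d - 2 * int r) \<and>
     (\<forall>\<sigma>. \<sigma> permutes {1..r} \<longrightarrow> op_act P (r + n) (d - 2 * int r) \<sigma> (f r) = f r)}"

definition Tw_act ::
    "('k, 'o, 'z) graded_operad_scheme \<Rightarrow> nat \<Rightarrow> int \<Rightarrow> (nat \<Rightarrow> nat) \<Rightarrow> (nat \<Rightarrow> 'o) \<Rightarrow> nat \<Rightarrow> 'o" where
  "Tw_act P n d \<sigma> f r =
     op_label P (d - 2 * int r) ([1..<r + 1] @ map (\<lambda>j. r + \<sigma> j) [1..<n + 1]) (f r)"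

definition Tw_circ ::
    "('k, 'o::ab_group_add, 'z) graded_operad_scheme \<Rightarrow> nat \<Rightarrow> int \<Rightarrow> nat \<Rightarrow> int \<Rightarrow> nat \<Rightarrow>
     (nat \<Rightarrow> 'o) \<Rightarrow> (nat \<Rightarrow> 'o) \<Rightarrow> nat \<Rightarrow> 'o" where
  "Tw_circ P n d m e i f g r =
     (\<Sum>p=0..r. \<Sum>\<sigma>\<in>Sh p (r - p).
        op_comp_label P (d - 2 * int p) (e - 2 * int (r - p))
          (f p) (map \<sigma> [1..<p + 1] @ [r + 1..<r + i])
          (g (r - p)) (map \<sigma> [p + 1..<r + 1] @ [r + i..<r + i + m])
          [r + i + m..<r + n + m])"

definition Tw_diff ::
    "('k, 'o::ab_group_add, 'z) dg_operad_scheme \<Rightarrow> (nat \<Rightarrow> 'o) \<Rightarrow> nat \<Rightarrow> int \<Rightarrow> (nat \<Rightarrow> 'o) \<Rightarrow> nat \<Rightarrow> 'o" where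
  "Tw_diff P ph n d f r =
     (let \<kappa> = (\<lambda>r. ph (r + 1)) in
       op_diff P (r + n) (d - 2 * int r) (f r)
       - sg d (\<Sum>p=1..r. \<Sum>\<sigma>\<in>Sh p (r - p).
           op_comp_label P (d - 2 * int (r - p + 1)) (3 - 2 * int p)
             (f (r - p + 1)) [] (ph p) (map \<sigma> [1..<p + 1])
             (map \<sigma> [p + 1..<r + 1] @ [r + 1..<r + n + 1]))
       + Tw_circ P 1 1 n d 1 \<kappa> f r
       - sg d (\<Sum>i=1..n. Tw_circ P n d 1 1 i f \<kappa> r))"

definition Tw :: "('k, 'o::ab_group_add, 'z) dg_operad_scheme \<Rightarrow> (nat \<Rightarrow> 'o) \<Rightarrow> ('k, nat \<Rightarrow> 'o) dg_operad" where
  "Tw P ph =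
     \<lparr> op_car = Tw_car P,
       op_scale = (\<lambda>a f r. op_scale P a (f r)),
       op_unit = (\<lambda>r. if r = 0 then op_unit P else 0),
       op_act = Tw_act P,
       op_circ = Tw_circ P,
       op_diff = Tw_diff P ph \<rparr>"

definition Tw_map :: "('k, 'o, 'z) graded_operad_scheme \<Rightarrow> ('o, 'p) op_map \<Rightarrow> (nat \<Rightarrow> 'o, nat \<Rightarrow> 'p) op_map" where
  "Tw_map P G n d = (\<lambda>f\<in>Tw_car P n d. \<lambda>r. G (r + n) (d - 2 * int r) (f r))"

definition Tw_eta :: "('k, 'o, 'z) graded_operad_scheme \<Rightarrow> (nat \<Rightarrow> 'o, 'o) op_map" where
  "Tw_eta P n d = (\<lambda>f\<in>Tw_car P n d. f 0)"

definition Tw_delta :: "('k, 'o, 'z) graded_operad_scheme \<Rightarrow> (nat \<Rightarrow> 'o, nat \<Rightarrow> nat \<Rightarrow> 'o) op_map" where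
  "Tw_delta P n d = (\<lambda>f\<in>Tw_car P n d. \<lambda>r s. f (s + r))"

definition Tw_beta ::
    "('k, 'l::ab_group_add, 'y) dg_operad_scheme \<Rightarrow> (nat \<Rightarrow> 'l) \<Rightarrow> ('k, 'o::ab_group_add, 'z) dg_operad_scheme \<Rightarrow>
     (nat \<Rightarrow> 'o) \<Rightarrow> ('l, nat \<Rightarrow> 'o) op_map" where
  "Tw_beta L lam P ph =
     (THE B. dg_operad_map L (Tw P ph) B \<and>
        (\<forall>n\<ge>2. B n (3 - 2 * int n) (lam n) = (\<lambda>r. ph (r + n))))"

definition Tw_coalgebra ::
    "('k::field, 'l::ab_group_add, 'y) dg_operad_scheme \<Rightarrow> (nat \<Rightarrow> 'l) \<Rightarrow>
     ('k, 'o::ab_group_add, 'z) dg_operad_scheme \<Rightarrow> ('l, 'o) op_map \<Rightarrow> ('o, nat \<Rightarrow> 'o) op_map \<Rightarrow> bool" where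
  "Tw_coalgebra L lam P F c \<longleftrightarrow>
     is_dg_operad P \<and> dg_operad_map L P F \<and> dg_operad_map P (Tw P (phi lam F)) c \<and>
     op_compose L c F = Tw_beta L lam P (phi lam F) \<and>
     op_compose P (Tw_eta P) c = op_id P \<and>
     op_compose P (Tw_map P c) c = op_compose P (Tw_delta P) c"

definition Tw_coalgebra_map ::
    "('k, 'l::ab_group_add, 'x) dg_operad_scheme \<Rightarrow>
     ('k, 'o::ab_group_add, 'y) dg_operad_scheme \<Rightarrow> ('l, 'o) op_map \<Rightarrow> ('o, nat \<Rightarrow> 'o) op_map \<Rightarrow>
     ('k, 'p::ab_group_add, 'z) dg_operad_scheme \<Rightarrow> ('l, 'p) op_map \<Rightarrow> ('p, nat \<Rightarrow> 'p) op_map \<Rightarrow>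
     ('o, 'p) op_map \<Rightarrow> bool" where
  "Tw_coalgebra_map L P F c P' F' c' \<Psi> \<longleftrightarrow>
     dg_operad_map P P' \<Psi> \<and> op_compose L \<Psi> F = F' \<and>
     op_compose P c' \<Psi> = op_compose P (Tw_map P \<Psi>) c"

section \<open>Algebras\<close>

record ('k, 'v) complx =
  cc :: "int \<Rightarrow> 'v set"
  scl :: "'k \<Rightarrow> 'v \<Rightarrow> 'v"
  dif :: "int \<Rightarrow> 'v \<Rightarrow> 'v"

definition is_complex :: "('k::field, 'v::ab_group_add, 'z) complx_scheme \<Rightarrow> bool" where
  "is_complex V \<longleftrightarrow>
     vector_space (scl V) \<and>
     (\<forall>d. module.subspace (scl V) (cc V d)) \<and>
     (\<forall>d. lin_on (scl V) (scl V) (cc V d) (dif V d)) \<and>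
     (\<forall>d. \<forall>x\<in>cc V d. dif V d x \<in> cc V (d + 1) \<and> dif V (d + 1) (dif V d x) = 0)"

text \<open>Tuples of homogeneous elements, each listed together with its degree.\<close>

definition hlists :: "('k, 'v, 'z) complx_scheme \<Rightarrow> nat \<Rightarrow> (int \<times> 'v) list set" where
  "hlists V n = {xs. length xs = n \<and> (\<forall>(d, x)\<in>set xs. x \<in> cc V d)}"

definition degs :: "(int \<times> 'v) list \<Rightarrow> int" where
  "degs xs = sum_list (map fst xs)"

text \<open>
  The endomorphism operad, with the usual Koszul signs.  A map \<open>V\<^bsup>\<otimes>n\<^esup> \<rightarrow> V\<close> of degree \<open>e\<close> is a
  family of multilinear maps \<open>V\<^bsup>d\<^sub>1\<^esup> \<times> \<dots> \<times> V\<^bsup>d\<^sub>n\<^esup> \<rightarrow> V\<^bsup>e + d\<^sub>1 + \<dots> + d\<^sub>n\<^esup>\<close>, extended by zero to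
  lists outside \<^const>\<open>hlists\<close>.
\<close>

definition End_car ::
    "('k, 'v::ab_group_add, 'z) complx_scheme \<Rightarrow> nat \<Rightarrow> int \<Rightarrow> ((int \<times> 'v) list \<Rightarrow> 'v) set" where
  "End_car V n e = {f.
     (\<forall>xs. xs \<notin> hlists V n \<longrightarrow> f xs = 0) \<and>
     (\<forall>xs\<in>hlists V n. f xs \<in> cc V (e + degs xs)) \<and>
     (\<forall>xs\<in>hlists V n. \<forall>j<n.
        lin_on (scl V) (scl V) (cc V (fst (xs ! j))) (\<lambda>y. f (xs[j := (fst (xs ! j), y)])))}"

definition koszul :: "(nat \<Rightarrow> nat) \<Rightarrow> (int \<times> 'v) list \<Rightarrow> int" where
  "koszul \<sigma> xs =
     (\<Sum>(a, b) | 1 \<le> a \<and> a < b \<and> b \<le> length xs \<and> \<sigma> b < \<sigma> a.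
        fst (xs ! (\<sigma> a - 1)) * fst (xs ! (\<sigma> b - 1)))"

definition End_op ::
    "('k, 'v::ab_group_add, 'z) complx_scheme \<Rightarrow> ('k, (int \<times> 'v) list \<Rightarrow> 'v) dg_operad" where
  "End_op V =
     \<lparr> op_car = End_car V,
       op_scale = (\<lambda>a f xs. scl V a (f xs)),
       op_unit = (\<lambda>xs. if xs \<in> hlists V 1 then snd (hd xs) else 0),
       op_act = (\<lambda>n e \<sigma> f xs. if xs \<in> hlists V n
          then sg (koszul \<sigma> xs) (f (map (\<lambda>j. xs ! (\<sigma> j - 1)) [1..<n + 1])) else 0),
       op_circ = (\<lambda>k d m e i f g xs. if xs \<in> hlists V (k + m - 1)
          then (let as = take (i - 1) xs; bs = take m (drop (i - 1) xs); cs = drop (i - 1 + m) xs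
                in sg (e * degs as) (f (as @ [(e + degs bs, g bs)] @ cs))) else 0),
       op_diff = (\<lambda>n e f xs. if xs \<in> hlists V n
          then dif V (e + degs xs) (f xs)
               - sg e (\<Sum>j<n. sg (degs (take j xs))
                   (f (xs[j := (fst (xs ! j) + 1, dif V (fst (xs ! j)) (snd (xs ! j)))]))) else 0) \<rparr>"

record ('k, 'o, 'v) dg_alg = "('k, 'v) complx" +
  act :: "('o, (int \<times> 'v) list \<Rightarrow> 'v) op_map"

definition is_algebra ::
    "('k::field, 'o::ab_group_add, 'y) dg_operad_scheme \<Rightarrow> ('k, 'o, 'v::ab_group_add, 'z) dg_alg_scheme \<Rightarrow> bool" where
  "is_algebra P A \<longleftrightarrow> is_complex A \<and> dg_operad_map P (End_op A) (act A)"

definition is_alg_hom ::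
    "('k, 'o, 'x) graded_operad_scheme \<Rightarrow> ('k, 'o, 'v::ab_group_add, 'y) dg_alg_scheme \<Rightarrow>
     ('k, 'o, 'v, 'z) dg_alg_scheme \<Rightarrow> (int \<Rightarrow> 'v \<Rightarrow> 'v) \<Rightarrow> bool" where
  "is_alg_hom P A B f \<longleftrightarrow>
     (\<forall>d. f d \<in> cc A d \<rightarrow>\<^sub>E cc B d) \<and>
     (\<forall>d. lin_on (scl A) (scl B) (cc A d) (f d)) \<and>
     (\<forall>d. \<forall>x\<in>cc A d. f (d + 1) (dif A d x) = dif B d (f d x)) \<and>
     (\<forall>n e. \<forall>\<gamma>\<in>op_car P n e. \<forall>xs\<in>hlists A n.
        f (e + degs xs) (act A n e \<gamma> xs) = act B n e \<gamma> (map (\<lambda>(d, x). (d, f d x)) xs))"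

text \<open>\<open>filt A k d\<close> is the degree \<open>d\<close> part of \<open>\<F>\<^sub>k\<close> and \<open>mc A\<close> is the Maurer-Cartan element.\<close>

record ('k, 'o, 'v) mc_alg = "('k, 'o, 'v) dg_alg" +
  filt :: "nat \<Rightarrow> int \<Rightarrow> 'v set"
  mc :: "'v"

text \<open>The sum of a series of elements of degree \<open>d\<close>, in the topology of the filtration.\<close>

definition filt_sum :: "('k, 'o, 'v::ab_group_add, 'z) mc_alg_scheme \<Rightarrow> int \<Rightarrow> (nat \<Rightarrow> 'v) \<Rightarrow> 'v" where
  "filt_sum A d t = (THE s. s \<in> cc A d \<and> (\<forall>k. \<exists>N. \<forall>m\<ge>N. (\<Sum>r<m. t r) - s \<in> filt A k d))"

text \<open>
  The last condition spells out that \<open>V \<rightarrow> lim V/\<F>\<^sub>k V\<close> is injective and surjective in every degree.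
\<close>

definition complete_filtration :: "('k::field, 'o, 'v::ab_group_add, 'z) mc_alg_scheme \<Rightarrow> bool" where
  "complete_filtration A \<longleftrightarrow>
     (\<forall>d. filt A 0 d = cc A d) \<and>
     (\<forall>k d. filt A (k + 1) d \<subseteq> filt A k d) \<and>
     (\<forall>k d. module.subspace (scl A) (filt A k d)) \<and>
     (\<forall>d. (\<Inter>k. filt A k d) = {0} \<and>
          (\<forall>xs. (\<forall>k. xs k \<in> cc A d \<and> xs (k + 1) - xs k \<in> filt A k d) \<longrightarrow>
             (\<exists>x\<in>cc A d. \<forall>k. x - xs k \<in> filt A k d)))"

definition filtration_compatible ::
    "('k, 'o, 'y) graded_operad_scheme \<Rightarrow> ('k, 'o, 'v, 'z) mc_alg_scheme \<Rightarrow> bool" where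
  "filtration_compatible P A \<longleftrightarrow>
     (\<forall>k d. \<forall>x\<in>filt A k d. dif A d x \<in> filt A k (d + 1)) \<and>
     (\<forall>n e. \<forall>\<gamma>\<in>op_car P n e. \<forall>xs\<in>hlists A n. \<forall>is. length is = n \<longrightarrow>
        (\<forall>j<n. snd (xs ! j) \<in> filt A (is ! j) (fst (xs ! j))) \<longrightarrow>
        act A n e \<gamma> xs \<in> filt A (sum_list is) (e + degs xs))"

definition is_mc :: "(nat \<Rightarrow> 'o) \<Rightarrow> ('k::field_char_0, 'o, 'v::ab_group_add, 'z) mc_alg_scheme \<Rightarrow> bool" where
  "is_mc ph A \<longleftrightarrow>
     mc A \<in> filt A 1 2 \<and>
     dif A 2 (mc A) +
       filt_sum A 3 (\<lambda>n. if n \<ge> 2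
          then scl A (1 / fact n) (act A n (3 - 2 * int n) (ph n) (replicate n (2, mc A))) else 0) = 0"

definition is_mc_algebra ::
    "('k::field_char_0, 'o::ab_group_add, 'y) dg_operad_scheme \<Rightarrow> (nat \<Rightarrow> 'o) \<Rightarrow>
     ('k, 'o, 'v::ab_group_add, 'z) mc_alg_scheme \<Rightarrow> bool" where
  "is_mc_algebra P ph A \<longleftrightarrow>
     is_algebra P A \<and> complete_filtration A \<and> filtration_compatible P A \<and> is_mc ph A"

definition is_mc_hom ::
    "('k, 'o, 'x) graded_operad_scheme \<Rightarrow> ('k, 'o, 'v::ab_group_add, 'y) mc_alg_scheme \<Rightarrow>
     ('k, 'o, 'v, 'z) mc_alg_scheme \<Rightarrow> (int \<Rightarrow> 'v \<Rightarrow> 'v) \<Rightarrow> bool" where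
  "is_mc_hom P A B f \<longleftrightarrow>
     is_alg_hom P A B f \<and>
     (\<forall>k d. f d ` filt A k d \<subseteq> filt B k d) \<and>
     f 2 (mc A) = mc B"

section \<open>Categories and functors\<close>

record ('ob, 'ar) Category =
  Obj :: "'ob set"
  Hom :: "'ob \<Rightarrow> 'ob \<Rightarrow> 'ar set"
  Idt :: "'ob \<Rightarrow> 'ar"
  Cmp :: "'ob \<Rightarrow> 'ob \<Rightarrow> 'ob \<Rightarrow> 'ar \<Rightarrow> 'ar \<Rightarrow> 'ar"

record ('ob1, 'ar1, 'ob2, 'ar2) Functor =
  Dom :: "('ob1, 'ar1) Category"
  Cod :: "('ob2, 'ar2) Category"
  onObj :: "'ob1 \<Rightarrow> 'ob2"
  onHom :: "'ob1 \<Rightarrow> 'ob1 \<Rightarrow> 'ar1 \<Rightarrow> 'ar2"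

text \<open>
  Composites are restricted to the objects and morphisms of the source category, so that equality
  of composites is equality of functors.
\<close>

definition comp_functor ::
    "('b, 'bb, 'c, 'cc) Functor \<Rightarrow> ('a, 'aa, 'b, 'bb) Functor \<Rightarrow> ('a, 'aa, 'c, 'cc) Functor"
    (infixr "\<circ>\<^sub>F" 55) where
  "G \<circ>\<^sub>F F =
     \<lparr> Dom = Dom F, Cod = Cod G,
       onObj = (\<lambda>X\<in>Obj (Dom F). onObj G (onObj F X)),
       onHom = (\<lambda>X\<in>Obj (Dom F). \<lambda>Y\<in>Obj (Dom F). \<lambda>f\<in>Hom (Dom F) X Y.
                  onHom G (onObj F X) (onObj F Y) (onHom F X Y f)) \<rparr>"

definition Alg ::
    "('k::field, 'o::ab_group_add, 'z) dg_operad_scheme \<Rightarrow>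
     (('k, 'o, 'v::ab_group_add) dg_alg, int \<Rightarrow> 'v \<Rightarrow> 'v) Category" where
  "Alg P =
     \<lparr> Obj = {A. is_algebra P A},
       Hom = (\<lambda>A B. {f. is_alg_hom P A B f}),
       Idt = (\<lambda>A d. \<lambda>x\<in>cc A d. x),
       Cmp = (\<lambda>A B C g f d. compose (cc A d) (g d) (f d)) \<rparr>"

definition AlgMC ::
    "('k::field_char_0, 'o::ab_group_add, 'z) dg_operad_scheme \<Rightarrow> (nat \<Rightarrow> 'o) \<Rightarrow>
     (('k, 'o, 'v::ab_group_add) mc_alg, int \<Rightarrow> 'v \<Rightarrow> 'v) Category" where
  "AlgMC P ph =
     \<lparr> Obj = {A. is_mc_algebra P ph A},
       Hom = (\<lambda>A B. {f. is_mc_hom P A B f}),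
       Idt = (\<lambda>A d. \<lambda>x\<in>cc A d. x),
       Cmp = (\<lambda>A B C g f d. compose (cc A d) (g d) (f d)) \<rparr>"

definition ATw_alg ::
    "('k::field_char_0, 'o::ab_group_add, 'z) dg_operad_scheme \<Rightarrow> (nat \<Rightarrow> 'o) \<Rightarrow> ('o, nat \<Rightarrow> 'o) op_map \<Rightarrow>
     ('k, 'o, 'v::ab_group_add) mc_alg \<Rightarrow> ('k, 'o, 'v) dg_alg" where
  "ATw_alg P ph c A =
     \<lparr> cc = cc A,
       scl = scl A,
       dif = (\<lambda>d. \<lambda>x\<in>cc A d. dif A d x +
          filt_sum A (d + 1) (\<lambda>r. if r \<ge> 1
             then scl A (1 / fact r)
                    (act A (r + 1) (3 - 2 * int (r + 1)) (ph (r + 1)) (replicate r (2, mc A) @ [(d, x)]))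
             else 0)),
       act = (\<lambda>n e. \<lambda>\<gamma>\<in>op_car P n e. \<lambda>xs. if xs \<in> hlists A n
          then filt_sum A (e + degs xs) (\<lambda>r. scl A (1 / fact r)
                 (act A (r + n) (e - 2 * int r) (c n e \<gamma> r) (replicate r (2, mc A) @ xs)))
          else 0) \<rparr>"

definition ATw ::
    "('k::field_char_0, 'o::ab_group_add, 'z) dg_operad_scheme \<Rightarrow> (nat \<Rightarrow> 'o) \<Rightarrow> ('o, nat \<Rightarrow> 'o) op_map \<Rightarrow>
     (('k, 'o, 'v::ab_group_add) mc_alg, int \<Rightarrow> 'v \<Rightarrow> 'v, ('k, 'o, 'v) dg_alg, int \<Rightarrow> 'v \<Rightarrow> 'v) Functor" where
  "ATw P ph c =
     \<lparr> Dom = AlgMC P ph, Cod = Alg P, onObj = ATw_alg P ph c, onHom = (\<lambda>A B f. f) \<rparr>"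

definition restr ::
    "('k::field, 'o::ab_group_add, 'y) dg_operad_scheme \<Rightarrow> ('k, 'p::ab_group_add, 'z) dg_operad_scheme \<Rightarrow>
     ('o, 'p) op_map \<Rightarrow>
     (('k, 'p, 'v::ab_group_add) dg_alg, int \<Rightarrow> 'v \<Rightarrow> 'v, ('k, 'o, 'v) dg_alg, int \<Rightarrow> 'v \<Rightarrow> 'v) Functor" where
  "restr P P' \<Psi> =
     \<lparr> Dom = Alg P', Cod = Alg P,
       onObj = (\<lambda>A. \<lparr> cc = cc A, scl = scl A, dif = dif A, act = op_compose P (act A) \<Psi> \<rparr>),
       onHom = (\<lambda>A B f. f) \<rparr>"

definition restrMC ::
    "('k::field_char_0, 'o::ab_group_add, 'y) dg_operad_scheme \<Rightarrow> (nat \<Rightarrow> 'o) \<Rightarrow>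
     ('k, 'p::ab_group_add, 'z) dg_operad_scheme \<Rightarrow> (nat \<Rightarrow> 'p) \<Rightarrow> ('o, 'p) op_map \<Rightarrow>
     (('k, 'p, 'v::ab_group_add) mc_alg, int \<Rightarrow> 'v \<Rightarrow> 'v, ('k, 'o, 'v) mc_alg, int \<Rightarrow> 'v \<Rightarrow> 'v) Functor" where
  "restrMC P ph P' ph' \<Psi> =
     \<lparr> Dom = AlgMC P' ph', Cod = AlgMC P ph,
       onObj = (\<lambda>A. \<lparr> cc = cc A, scl = scl A, dif = dif A, act = op_compose P (act A) \<Psi>,
                      filt = filt A, mc = mc A \<rparr>),
       onHom = (\<lambda>A B f. f) \<rparr>"

end

theory Submission
  imports Defs
begin

text \<open>
  Restriction and twisting both leave the graded space, its filtration, the Maurer-Cartan element and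
  the underlying maps of morphisms alone.  The two composites can therefore differ only in the twisted
  differential and in the action on objects, and both of these are sums, in the topology of the
  filtration, of terms \<open>1/r! \<cdot> \<mu>(\<alpha>,\<dots>,\<alpha>,v\<^sub>1,\<dots>,v\<^sub>n)\<close>, where the operation \<open>\<mu>\<close> of \<open>\<O>'\<close> is the only
  thing that depends on the route taken.  For the differential the two operations are \<open>\<Psi>(\<phi>\<^sub>r\<^sub>+\<^sub>1)\<close>
  and \<open>\<phi>'\<^sub>r\<^sub>+\<^sub>1\<close>; they agree because \<open>\<Psi>\<close> is a map under \<open>\<Lambda>Lie\<^sub>\<infinity>\<close>
  (\<open>coalgebra_map_phi\<close>).  For the action of \<open>\<gamma>\<close> they are \<open>\<Psi>(c(\<gamma>)\<^sub>r)\<close> and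
  \<open>c'(\<Psi>(\<gamma>))\<^sub>r\<close>; they agree because \<open>\<Psi>\<close> intertwines the coalgebra structures
  (\<open>coalgebra_map_components\<close>).  So in each case the two series agree term by term, and their sums
  are taken with respect to the same filtration.
\<close>

lemma op_compose_apply: "v \<in> op_car P n d \<Longrightarrow> op_compose P G F n d v = G n d (F n d v)"
  by (simp add: op_compose_def compose_def)

lemma dg_operad_map_mem:
  "dg_operad_map P Q F \<Longrightarrow> v \<in> op_car P n d \<Longrightarrow> F n d v \<in> op_car Q n d"
  unfolding dg_operad_map_def graded_operad_map_def by blast

lemma phi_mem:
  assumes "invariant_gens L lam" and "dg_operad_map L P F" and "n \<ge> 2"
  shows "phi lam F n \<in> op_car P n (3 - 2 * int n)"
proof -
  have "lam n \<in> op_car L n (3 - 2 * int n)"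
    using assms(1,3) by (simp add: invariant_gens_def)
  with assms(2,3) show ?thesis by (simp add: phi_def dg_operad_map_mem)
qed

lemma coalgebra_map_phi:
  assumes "invariant_gens L lam" and "Tw_coalgebra_map L P F c P' F' c' \<Psi>" and "n \<ge> 2"
  shows "\<Psi> n (3 - 2 * int n) (phi lam F n) = phi lam F' n"
proof -
  have "lam n \<in> op_car L n (3 - 2 * int n)"
    using assms(1,3) by (simp add: invariant_gens_def)
  moreover have "F' = op_compose L \<Psi> F"
    using assms(2) by (simp add: Tw_coalgebra_map_def)
  ultimately show ?thesis using assms(3) by (simp add: phi_def op_compose_apply)
qed

lemma coalgebra_component_mem:
  assumes "Tw_coalgebra L lam P F c" and "\<gamma> \<in> op_car P n e"
  shows "c n e \<gamma> r \<in> op_car P (r + n) (e - 2 * int r)"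
proof -
  have "dg_operad_map P (Tw P (phi lam F)) c"
    using assms(1) by (simp add: Tw_coalgebra_def)
  from dg_operad_map_mem[OF this assms(2)] show ?thesis
    by (simp add: Tw_def Tw_car_def)
qed

lemma coalgebra_map_components:
  assumes "Tw_coalgebra L lam P F c" and "Tw_coalgebra_map L P F c P' F' c' \<Psi>"
    and "\<gamma> \<in> op_car P n e"
  shows "c' n e (\<Psi> n e \<gamma>) r = \<Psi> (r + n) (e - 2 * int r) (c n e \<gamma> r)"
proof -
  have "dg_operad_map P (Tw P (phi lam F)) c"
    using assms(1) by (simp add: Tw_coalgebra_def)
  from dg_operad_map_mem[OF this assms(3)] have mem: "c n e \<gamma> \<in> Tw_car P n e"
    by (simp add: Tw_def)
  have "op_compose P c' \<Psi> n e \<gamma> = op_compose P (Tw_map P \<Psi>) c n e \<gamma>"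
    using assms(2) by (simp add: Tw_coalgebra_map_def)
  with assms(3) have "c' n e (\<Psi> n e \<gamma>) = Tw_map P \<Psi> n e (c n e \<gamma>)"
    by (simp add: op_compose_apply)
  with mem show ?thesis by (simp add: Tw_map_def)
qed

text \<open>
  The sum of a series in the filtration topology is a function of its sequence of terms, the graded
  space and the filtration.  Restriction keeps the last two, so equal terms give equal sums.
\<close>

lemma ATw_restr_commute:
  assumes L: "invariant_gens L lam"
    and P: "Tw_coalgebra L lam P F c"
    and \<Psi>: "Tw_coalgebra_map L P F c P' F' c' \<Psi>"
  shows "ATw_alg P (phi lam F) c (onObj (restrMC P (phi lam F) P' (phi lam F') \<Psi>) A)
       = onObj (restr P P' \<Psi>) (ATw_alg P' (phi lam F') c' A)"
    (is "ATw_alg P _ c ?B = _")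
proof -
  have F: "dg_operad_map L P F" using P by (simp add: Tw_coalgebra_def)
  have \<Psi>': "dg_operad_map P P' \<Psi>" using \<Psi> by (simp add: Tw_coalgebra_map_def)
  have sum: "filt_sum ?B d t = filt_sum A d t" for d t
    by (simp add: filt_sum_def restrMC_def)
  have hl: "hlists ?B n = hlists A n" for n
    by (simp add: hlists_def restrMC_def)
  \<comment> \<open>The differential series starts at \<open>r = 1\<close>, so it only involves images of generators.\<close>
  have "act ?B (r + 1) (3 - 2 * int (r + 1)) (phi lam F (r + 1))
      = act A (r + 1) (3 - 2 * int (r + 1)) (phi lam F' (r + 1))" if "r \<ge> 1" for r
  proof -
    have "r + 1 \<ge> 2" using that by simp
    from phi_mem[OF L F this] coalgebra_map_phi[OF L \<Psi> this] show ?thesis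
      by (simp only: restrMC_def Functor.select_convs dg_alg.select_convs op_compose_apply)
  qed
  hence terms: "(\<lambda>r. if r \<ge> 1 then scl A (1 / fact r) (act ?B (r + 1) (3 - 2 * int (r + 1))
                (phi lam F (r + 1)) (replicate r (2, mc A) @ [(d, x)])) else 0)
     = (\<lambda>r. if r \<ge> 1 then scl A (1 / fact r) (act A (r + 1) (3 - 2 * int (r + 1))
                (phi lam F' (r + 1)) (replicate r (2, mc A) @ [(d, x)])) else 0)" for d x
    by (intro ext) presburger
  have B: "cc ?B = cc A" "scl ?B = scl A" "dif ?B = dif A" "mc ?B = mc A"
    by (simp_all add: restrMC_def)
  have dif_eq: "dif (ATw_alg P (phi lam F) c ?B) = dif (ATw_alg P' (phi lam F') c' A)"
    unfolding ATw_alg_def complx.select_convs sum B terms ..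
  have "act ?B (r + n) (e - 2 * int r) (c n e \<gamma> r)
      = act A (r + n) (e - 2 * int r) (c' n e (\<Psi> n e \<gamma>) r)" if "\<gamma> \<in> op_car P n e" for n e \<gamma> r
    using coalgebra_component_mem[OF P that, of r] coalgebra_map_components[OF P \<Psi> that, of r]
    by (simp only: restrMC_def Functor.select_convs dg_alg.select_convs op_compose_apply)
  \<comment> \<open>Equality of extensional maps: off the carrier of \<open>\<O>\<close> both sides take the default value, and on
    it the right-hand action is evaluated at \<open>\<Psi>(\<gamma>)\<close>, which lies in the carrier of \<open>\<O>'\<close>.\<close>
  hence act_eq: "act (ATw_alg P (phi lam F) c ?B) n e
      = op_compose P (act (ATw_alg P' (phi lam F') c' A)) \<Psi> n e" for n e
    by (auto simp: ATw_alg_def op_compose_def compose_def sum hl B fun_eq_iff restrict_def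
        dg_operad_map_mem[OF \<Psi>'])
  show ?thesis
    using dif_eq act_eq by (simp add: restr_def ATw_alg_def B fun_eq_iff)
qed

theorem theorem6p1:
  fixes L :: "('k::field_char_0, nat \<Rightarrow>\<^sub>0 'k) dg_operad"
    and lam :: "nat \<Rightarrow> (nat \<Rightarrow>\<^sub>0 'k)"
    and P :: "('k, 'o::ab_group_add) dg_operad"
    and P' :: "('k, 'p::ab_group_add) dg_operad"
    and F :: "(nat \<Rightarrow>\<^sub>0 'k, 'o) op_map"
    and F' :: "(nat \<Rightarrow>\<^sub>0 'k, 'p) op_map"
    and c :: "('o, nat \<Rightarrow> 'o) op_map"
    and c' :: "('p, nat \<Rightarrow> 'p) op_map"
    and \<Psi> :: "('o, 'p) op_map"
  assumes "is_Lambda_Lie_inf L lam"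
    and "Tw_coalgebra L lam P F c"
    and "Tw_coalgebra L lam P' F' c'"
    and "Tw_coalgebra_map L P F c P' F' c' \<Psi>"
  shows "(ATw P (phi lam F) c \<circ>\<^sub>F restrMC P (phi lam F) P' (phi lam F') \<Psi>
            :: (('k, 'p, 'v::ab_group_add) mc_alg, int \<Rightarrow> 'v \<Rightarrow> 'v,
                ('k, 'o, 'v) dg_alg, int \<Rightarrow> 'v \<Rightarrow> 'v) Functor)
         = restr P P' \<Psi> \<circ>\<^sub>F ATw P' (phi lam F') c'"
proof -
  have "invariant_gens L lam" using assms(1) by (simp add: is_Lambda_Lie_inf_def)
  hence "ATw_alg P (phi lam F) c (onObj (restrMC P (phi lam F) P' (phi lam F') \<Psi>) A)
      = onObj (restr P P' \<Psi>) (ATw_alg P' (phi lam F') c' A)" for A :: "('k, 'p, 'v) mc_alg"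
    using assms(2,4) by (rule ATw_restr_commute)
  thus ?thesis
    by (simp add: comp_functor_def ATw_def restr_def restrMC_def restrict_def fun_eq_iff)
qed

end
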